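(* Let $n\ge1$ and let $\xi_1,\dots,\xi_n$ be independent and symmetric real-valued random variables. Let $S_k=\sum_{i=1}^k\xi_i$ and $[S]_n=\sum_{i=1}^n\xi_i^2$. Then, for all $x>0$, $$\mathbf{P}\left(\max_{1\le k\le n}\frac{S_k}{\sqrt{[S]_n}}\ge x\right)\le\exp\left\{-\frac{x^2}{2}\right\},$$ where by convention $\frac00=0$.
   Context: A random variable $\xi$ is symmetric if $\xi$ and $-\xi$ have the same distribution. *)

theory Defs
  imports "HOL-Probability.Probability"
begin

definition symmetric_rv :: "'a measure \<Rightarrow> ('a \<Rightarrow> real) \<Rightarrow> bool" where
  "symmetric_rv M X \<longleftrightarrow>
     X \<in> borel_measurable M \<and> distr M borel X = distr M borel (\<lambda>\<omega>. - X \<omega>)"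

definition partial_sum :: "(nat \<Rightarrow> 'a \<Rightarrow> real) \<Rightarrow> nat \<Rightarrow> 'a \<Rightarrow> real" where
  "partial_sum \<xi> k \<omega> = (\<Sum>i=1..k. \<xi> i \<omega>)"

definition square_bracket :: "(nat \<Rightarrow> 'a \<Rightarrow> real) \<Rightarrow> nat \<Rightarrow> 'a \<Rightarrow> real" where
  "square_bracket \<xi> n \<omega> = (\<Sum>i=1..n. (\<xi> i \<omega>)\<^sup>2)"

end

theory Submission
  imports Defs
begin

text \<open>
  By symmetry and independence, flipping the signs of any subset of the \<open>\<xi> i\<close> does not change
  their joint distribution, so the probability in question is the expectation of the proportion
  of sign patterns for which the event holds at the point \<open>\<omega>\<close>.  Flipping signs leaves
  \<open>[S]\<^sub>n\<close> unchanged, so that proportion is a maximal tail probability of a Rademacher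
  sum with fixed coefficients \<open>a i = \<xi> i \<omega>\<close>, for which Doob's exponential maximal inequality
  together with \<open>cosh t \<le> exp (t\<^sup>2 / 2)\<close> gives the bound \<open>exp (- x\<^sup>2 / 2)\<close> pointwise.
\<close>

definition flip :: "'i set \<Rightarrow> 'i \<Rightarrow> real" where
  "flip B i = (if i \<in> B then - 1 else 1)"

lemma flip_power2 [simp]: "(flip B i)\<^sup>2 = 1"
  by (simp add: flip_def)

text \<open>Hoeffding's bound for a fair sign: with probability 1/2 and exponent
  \<open>2 * t\<close>, the left side of the auxiliary inequality collapses to
  \<open>ln (cosh t)\<close>. It is applied for nonnegative \<open>t\<close>; evenness of both sides
  covers the rest.\<close>

lemma cosh_le_exp_half_square: "cosh (t::real) \<le> exp (t\<^sup>2 / 2)"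
proof -
  have *: "cosh t \<le> exp (t\<^sup>2 / 2)" if "t \<ge> 0" for t :: real
  proof -
    have "-(2 * t) * (1/2) + ln (1 + 1/2 * (exp (2 * t) - 1)) \<le> (2 * t)\<^sup>2 / 8"
      by (rule Hoeffdings_lemma_aux) (use that in auto)
    moreover have "1 + 1/2 * (exp (2 * t) - 1) = exp t * cosh t"
      by (simp add: cosh_def field_simps flip: exp_add)
    ultimately have "ln (cosh t) \<le> t\<^sup>2 / 2"
      by (simp add: ln_mult power2_eq_square)
    then show ?thesis
      by (metis cosh_real_pos exp_le_cancel_iff exp_ln)
  qed
  show ?thesis
    using *[of "\<bar>t\<bar>"] by simp
qed

lemma sum_Pow_insert:
  fixes f :: "'a set \<Rightarrow> 'b::comm_monoid_add"
  assumes "finite A" "a \<notin> A"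
  shows "(\<Sum>B\<in>Pow (insert a A). f B) = (\<Sum>B\<in>Pow A. f B + f (insert a B))"
proof -
  have "inj_on (insert a) (Pow A)"
    using assms(2) by (auto simp: inj_on_def)
  moreover have "Pow A \<inter> insert a ` Pow A = {}"
    using assms(2) by auto
  ultimately show ?thesis
    using assms(1) by (simp add: Pow_insert sum.union_disjoint sum.reindex sum.distrib)
qed

text \<open>
  The summand is \<open>exp (l * S B n)\<close> frozen at the level \<open>exp (l * c)\<close> once the walk has reached
  \<open>c\<close>; this makes the bound inductive in \<open>n\<close>, without stopping times.
\<close>
lemma rademacher_exp_maximal:
  fixes a :: "nat \<Rightarrow> real" and c l :: real
  assumes "l \<ge> 0"
  defines "S \<equiv> \<lambda>B k. \<Sum>i=1..k. flip B i * a i"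
  shows "(\<Sum>B\<in>Pow {1..n}. if \<exists>k\<in>{1..n}. c \<le> S B k then exp (l * c) else exp (l * S B n))
           \<le> 2 ^ n * exp (l\<^sup>2 * (\<Sum>i=1..n. (a i)\<^sup>2) / 2)"
proof (induction n)
  case 0
  show ?case by (simp add: S_def)
next
  case (Suc n)
  define G where
    "G = (\<lambda>n B. if \<exists>k\<in>{1..n}. c \<le> S B k then exp (l * c) else exp (l * S B n))"
  let ?b = "l * a (Suc n)"
  have step: "G (Suc n) B + G (Suc n) (insert (Suc n) B) \<le> 2 * cosh ?b * G n B"
    if "B \<in> Pow {1..n}" for B
  proof -
    have S_eq: "S (insert (Suc n) B) k = S B k" if "k \<le> n" for k
      unfolding S_def using that by (intro sum.cong) (auto simp: flip_def)
    have "Suc n \<notin> B"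
      using that by auto
    then have S1: "S B (Suc n) = S B n + a (Suc n)"
      and S2: "S (insert (Suc n) B) (Suc n) = S B n - a (Suc n)"
      using S_eq[of n] by (simp_all add: S_def flip_def)
    show ?thesis
    proof (cases "\<exists>k\<in>{1..n}. c \<le> S B k")
      case True
      then obtain k where k: "k \<in> {1..n}" "c \<le> S B k"
        by blast
      then have "\<exists>k\<in>{1..Suc n}. c \<le> S B k" "\<exists>k\<in>{1..Suc n}. c \<le> S (insert (Suc n) B) k"
        using S_eq[of k] by (auto intro!: bexI[of _ k])
      with True have "G n B = exp (l * c)" "G (Suc n) B = exp (l * c)"
          "G (Suc n) (insert (Suc n) B) = exp (l * c)"
        by (simp_all only: G_def if_True)
      \<comment> \<open>Both extensions stay frozen at the same value, so only
        \<open>cosh ?b \<ge> 1\<close> is needed.\<close>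
      then show ?thesis
        using cosh_real_ge_1[of ?b] by simp
    next
      case False
      \<comment> \<open>If the walk first reaches \<open>c\<close> at time \<open>Suc n\<close>, it
        may overshoot; since \<open>l \<ge> 0\<close>, freezing at \<open>c\<close> can only lower
        the weight.\<close>
      have upper: "G (Suc n) B' \<le> exp (l * S B' (Suc n))"
        if "\<And>k. k \<le> n \<Longrightarrow> S B' k = S B k" for B'
      proof (cases "c \<le> S B' (Suc n)")
        case True
        then show ?thesis
          using \<open>l \<ge> 0\<close> by (auto simp: G_def mult_left_mono)
      next
        case c: False
        have "\<not> (\<exists>k\<in>{1..Suc n}. c \<le> S B' k)"
          using c False that by (auto simp: le_Suc_eq)
        then show ?thesis
          by (simp add: G_def)
      qed
      have "G (Suc n) B + G (Suc n) (insert (Suc n) B)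
              \<le> exp (l * S B (Suc n)) + exp (l * S (insert (Suc n) B) (Suc n))"
        by (intro add_mono upper) (auto simp: S_eq)
      also have "\<dots> = 2 * cosh ?b * exp (l * S B n)"
        unfolding S1 S2 by (simp add: cosh_def algebra_simps exp_add exp_diff exp_minus field_simps)
      also have "exp (l * S B n) = G n B"
        using False by (simp add: G_def)
      finally show ?thesis .
    qed
  qed
  have "{1..Suc n} = insert (Suc n) {1..n}"
    by auto
  then have "(\<Sum>B\<in>Pow {1..Suc n}. G (Suc n) B)
      = (\<Sum>B\<in>Pow {1..n}. G (Suc n) B + G (Suc n) (insert (Suc n) B))"
    using sum_Pow_insert[of "{1..n}" "Suc n" "G (Suc n)"] by simp
  also have "\<dots> \<le> 2 * cosh ?b * (\<Sum>B\<in>Pow {1..n}. G n B)"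
    unfolding sum_distrib_left by (intro sum_mono step)
  also have "\<dots> \<le> (2 * exp (?b\<^sup>2 / 2)) * (2 ^ n * exp (l\<^sup>2 * (\<Sum>i=1..n. (a i)\<^sup>2) / 2))"
    using Suc.IH unfolding G_def
    by (intro mult_mono mult_left_mono cosh_le_exp_half_square) (auto intro!: sum_nonneg)
  also have "\<dots> = 2 ^ Suc n * exp (l\<^sup>2 * (\<Sum>i=1..Suc n. (a i)\<^sup>2) / 2)"
    by (simp add: power_mult_distrib algebra_simps add_divide_distrib exp_add)
  finally show ?case
    unfolding G_def .
qed

lemma rademacher_self_normalized_maximal:
  fixes a :: "nat \<Rightarrow> real" and n :: nat
  assumes "x > 0"
  defines "V \<equiv> \<Sum>i=1..n. (a i)\<^sup>2"
  shows "real (card {B \<in> Pow {1..n}. \<exists>k\<in>{1..n}. x \<le> (\<Sum>i=1..k. flip B i * a i) / sqrt V})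
           \<le> 2 ^ n * exp (- (x\<^sup>2 / 2))"
proof (cases "V = 0")
  case True
  \<comment> \<open>all ratios are \<open>_ / 0 = 0 < x\<close>\<close>
  then show ?thesis using \<open>x > 0\<close> by simp
next
  case False
  moreover have "V \<ge> 0"
    unfolding V_def by (intro sum_nonneg) auto
  ultimately have "V > 0" by simp
  define c where "c = x * sqrt V"
  \<comment> \<open>This is \<open>c / V\<close>, the minimiser of the exponent
    \<open>l\<^sup>2 * V / 2 - l * c\<close>; its minimum is
    \<open>- (x\<^sup>2 / 2)\<close>.\<close>
  define l where "l = x / sqrt V"
  define S where "S = (\<lambda>B k. \<Sum>i=1..k. flip B i * a i)"
  have lc: "l * c = x\<^sup>2" and lV: "l\<^sup>2 * V = x\<^sup>2" and "l \<ge> 0"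
    using \<open>V > 0\<close> \<open>x > 0\<close> by (simp_all add: l_def c_def power2_eq_square)
  define E where "E = {B \<in> Pow {1..n}. \<exists>k\<in>{1..n}. x \<le> S B k / sqrt V}"
  have E: "E = {B \<in> Pow {1..n}. \<exists>k\<in>{1..n}. c \<le> S B k}"
    using \<open>V > 0\<close> by (simp add: E_def c_def pos_le_divide_eq)
  have "real (card E) * exp (x\<^sup>2) = (\<Sum>B\<in>E. exp (l * c))"
    by (simp add: lc)
  also have "\<dots> = (\<Sum>B\<in>E. if \<exists>k\<in>{1..n}. c \<le> S B k then exp (l * c) else exp (l * S B n))"
    by (intro sum.cong) (auto simp: E)
  \<comment> \<open>Markov's inequality in counting form: patterns outside \<open>E\<close>
    contribute nonnegative terms.\<close>
  also have "\<dots> \<le> (\<Sum>B\<in>Pow {1..n}. if \<exists>k\<in>{1..n}. c \<le> S B k then exp (l * c) else exp (l * S B n))"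
    by (intro sum_mono2) (auto simp: E)
  also have "\<dots> \<le> 2 ^ n * exp (l\<^sup>2 * V / 2)"
    unfolding S_def V_def by (rule rademacher_exp_maximal) fact
  finally have "real (card E) * exp (x\<^sup>2) \<le> 2 ^ n * exp (x\<^sup>2 / 2)"
    by (simp only: lV)
  then have "real (card E) \<le> 2 ^ n * exp (x\<^sup>2 / 2) / exp (x\<^sup>2)"
    by (simp add: pos_le_divide_eq)
  also have "\<dots> = 2 ^ n * exp (- (x\<^sup>2 / 2))"
    by (simp add: exp_minus field_simps flip: exp_add)
  finally show ?thesis
    by (simp add: E_def S_def)
qed

text \<open>Independence makes both joint laws products of their marginals, and by symmetry a sign
  change leaves each marginal unchanged.\<close>

lemma (in prob_space) distr_flip_indep_symmetric:
  assumes "I \<noteq> {}" and indep: "indep_vars (\<lambda>_. borel) X I"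
    and sym: "\<And>i. i \<in> I \<Longrightarrow> symmetric_rv M (X i)"
  shows "distr M (\<Pi>\<^sub>M i\<in>I. borel) (\<lambda>\<omega>. \<lambda>i\<in>I. flip B i * X i \<omega>)
           = distr M (\<Pi>\<^sub>M i\<in>I. borel) (\<lambda>\<omega>. \<lambda>i\<in>I. X i \<omega>)"
proof -
  have rv: "random_variable borel (X i)" if "i \<in> I" for i
    using sym[OF that] by (simp add: symmetric_rv_def)
  have "indep_vars (\<lambda>_. borel) (\<lambda>i \<omega>. flip B i * X i \<omega>) I"
    using indep by (rule indep_vars_compose2) simp
  then have "distr M (\<Pi>\<^sub>M i\<in>I. borel) (\<lambda>\<omega>. \<lambda>i\<in>I. flip B i * X i \<omega>)
      = (\<Pi>\<^sub>M i\<in>I. distr M borel (\<lambda>\<omega>. flip B i * X i \<omega>))"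
    using \<open>I \<noteq> {}\<close> rv by (subst (asm) indep_vars_iff_distr_eq_PiM') auto
  also have "\<dots> = (\<Pi>\<^sub>M i\<in>I. distr M borel (X i))"
    using sym by (intro PiM_cong) (auto simp: flip_def symmetric_rv_def)
  also have "\<dots> = distr M (\<Pi>\<^sub>M i\<in>I. borel) (\<lambda>\<omega>. \<lambda>i\<in>I. X i \<omega>)"
    using indep \<open>I \<noteq> {}\<close> rv by (subst (asm) indep_vars_iff_distr_eq_PiM') auto
  finally show ?thesis .
qed

theorem mainTheorem6:
  fixes M :: "'a measure" and \<xi> :: "nat \<Rightarrow> 'a \<Rightarrow> real" and n :: nat and x :: real
  assumes "prob_space M"
    and "n \<ge> 1"
    and "prob_space.indep_vars M (\<lambda>_. borel) \<xi> {1..n}"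
    and "\<And>i. i \<in> {1..n} \<Longrightarrow> symmetric_rv M (\<xi> i)"
    and "x > 0"
  shows "measure M {\<omega> \<in> space M.
           (MAX k\<in>{1..n}. partial_sum \<xi> k \<omega> / sqrt (square_bracket \<xi> n \<omega>)) \<ge> x}
         \<le> exp (- (x\<^sup>2 / 2))"
proof -
  interpret prob_space M by fact
  have [measurable]: "\<xi> i \<in> borel_measurable M" if "i \<in> {1..n}" for i
    using assms(4)[OF that] by (simp add: symmetric_rv_def)
  define R :: "(nat \<Rightarrow> real) \<Rightarrow> nat \<Rightarrow> real"
    where "R = (\<lambda>f k. (\<Sum>i=1..k. f i) / sqrt (\<Sum>i=1..n. (f i)\<^sup>2))"
  define P where "P = (\<lambda>f. \<exists>k\<in>{1..n}. x \<le> R f k)"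
  define N where "N = (\<Pi>\<^sub>M i\<in>{1..n}. (borel :: real measure))"
  define E where "E B = {\<omega> \<in> space M. P (\<lambda>i. flip B i * \<xi> i \<omega>)}" for B
  \<comment> \<open>Points of \<open>N\<close> are functions undefined off \<open>{1..n}\<close>. As
    \<open>P\<close> reads only those coordinates, each \<open>E B\<close> is the preimage of one
    fixed measurable set under the flipped vector.\<close>
  have P_restrict: "P (restrict f {1..n}) = P f" for f
  proof -
    have "R (restrict f {1..n}) k = R f k" if "k \<in> {1..n}" for k
      using that unfolding R_def
      by (intro arg_cong2[where f = "(/)"] arg_cong[where f = sqrt] sum.cong) auto
    then show ?thesis
      by (auto simp: P_def)
  qed
  have P_meas: "{f \<in> space N. P f} \<in> sets N"
  proof -
    have "(\<lambda>f. R f k) \<in> borel_measurable N" if "k \<in> {1..n}" for k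
      unfolding R_def N_def using that
      by (intro borel_measurable_divide borel_measurable_sum borel_measurable_sqrt
            borel_measurable_power measurable_component_singleton
            measurable_compose[OF _ borel_measurable_sqrt]) auto
    then show ?thesis
      unfolding P_def by measurable
  qed
  have flip_meas: "(\<lambda>\<omega>. \<lambda>i\<in>{1..n}. flip B i * \<xi> i \<omega>) \<in> measurable M N" for B
    unfolding N_def by measurable
  have E_vimage: "E B = (\<lambda>\<omega>. \<lambda>i\<in>{1..n}. flip B i * \<xi> i \<omega>) -` {f \<in> space N. P f} \<inter> space M" for B
    using measurable_space[OF flip_meas] by (auto simp: E_def P_restrict simp del: One_nat_def)
  have E_sets [measurable]: "E B \<in> events" for B
    unfolding E_vimage using flip_meas P_meas by (rule measurable_sets)
  have "prob (E B) = prob (E {})" for B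
  proof -
    have "prob (E B) = measure (distr M N (\<lambda>\<omega>. \<lambda>i\<in>{1..n}. flip B i * \<xi> i \<omega>)) {f \<in> space N. P f}" for B
      by (subst measure_distr[OF flip_meas P_meas]) (simp add: E_vimage)
    moreover have "distr M N (\<lambda>\<omega>. \<lambda>i\<in>{1..n}. flip B i * \<xi> i \<omega>) = distr M N (\<lambda>\<omega>. \<lambda>i\<in>{1..n}. \<xi> i \<omega>)" for B
      unfolding N_def using assms by (intro distr_flip_indep_symmetric) auto
    ultimately show ?thesis by simp
  qed
  then have "(\<Sum>B\<in>Pow {1..n}. prob (E B)) = (\<Sum>B\<in>Pow {1..n}. prob (E {}))"
    by (intro sum.cong refl)
  \<comment> \<open>All \<open>2 ^ n\<close> events are equally likely, so the original probability
    is the average over sign patterns.\<close>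
  then have "2 ^ n * prob (E {}) = (\<Sum>B\<in>Pow {1..n}. prob (E B))"
    by (simp add: card_Pow)
  also have "\<dots> = (\<Sum>B\<in>Pow {1..n}. expectation (indicator (E B)))"
    by simp
  also have "\<dots> = expectation (\<lambda>\<omega>. \<Sum>B\<in>Pow {1..n}. indicator (E B) \<omega>)"
    by (subst Bochner_Integration.integral_sum) (auto intro!: integrable_real_indicator simp: less_top[symmetric])
  also have "\<dots> \<le> expectation (\<lambda>\<omega>. 2 ^ n * exp (- (x\<^sup>2 / 2)))"
  proof (rule integral_mono)
    fix \<omega> assume "\<omega> \<in> space M"
    then have "(\<Sum>B\<in>Pow {1..n}. indicator (E B) \<omega> :: real)
        = card {B \<in> Pow {1..n}. P (\<lambda>i. flip B i * \<xi> i \<omega>)}"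
      by (simp add: E_def indicator_def sum.If_cases Int_def)
    also have "\<dots> \<le> 2 ^ n * exp (- (x\<^sup>2 / 2))"
      \<comment> \<open>With \<open>\<omega>\<close> fixed, the normaliser is the same for every
        \<open>B\<close> because \<open>flip\<close> squares to 1.\<close>
      using rademacher_self_normalized_maximal[OF \<open>x > 0\<close>, of n "\<lambda>i. \<xi> i \<omega>"]
      by (simp add: P_def R_def power_mult_distrib)
    finally show "(\<Sum>B\<in>Pow {1..n}. indicator (E B) \<omega>) \<le> 2 ^ n * exp (- (x\<^sup>2 / 2))" .
  qed (auto intro!: Bochner_Integration.integrable_sum integrable_real_indicator simp: less_top[symmetric])
  finally have "prob (E {}) \<le> exp (- (x\<^sup>2 / 2))"
    by (simp add: prob_space)
  \<comment> \<open>The empty set flips nothing, and \<open>n \<ge> 1\<close> makes the maximum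
    range over a nonempty set, so it reaches \<open>x\<close> exactly when some ratio does.\<close>
  moreover have "{\<omega> \<in> space M.
      (MAX k\<in>{1..n}. partial_sum \<xi> k \<omega> / sqrt (square_bracket \<xi> n \<omega>)) \<ge> x} = E {}"
    using \<open>n \<ge> 1\<close>
    by (auto simp: E_def P_def R_def flip_def partial_sum_def square_bracket_def Max_ge_iff)
  ultimately show ?thesis by simp
qed

end
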